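(* Let $n\ge 1$ be an integer. If a formula $\vartheta_n\in\mathrm{ML}$ separates the classes $\mathbb{A}_n$ and $\mathbb{B}_n$, then $\mathrm{s}(\vartheta_n)\ge\mathrm{twr}(n-1)$.
   Context: The function $\mathrm{twr}:\mathbb{N}\to\mathbb{N}$ is given by $\mathrm{twr}(0)=1$, $\mathrm{twr}(n+1)=2^{\mathrm{twr}(n)}$. The set of proposition symbols is empty. A pointed frame is a pair $(\mathcal{M},w)$ where $\mathcal{M}=(W,R)$ with $R\subseteq W\times W$ and $w\in W$. Write $\Box(\mathcal{M},w)=\{(\mathcal{M},v)\mid wR^{\mathcal{M}}v\}$. Formulas of $\mathrm{ML}$ are generated by $\varphi:=\top\mid\bot\mid(\varphi\wedge\varphi)\mid(\varphi\vee\varphi)\mid\Diamond\varphi\mid\Box\varphi$ with the usual Kripke semantics. The size $\mathrm{s}(\varphi)$ is the total number of occurrences of modal operators and binary connectives: $\mathrm{s}(\top)=\mathrm{s}(\bot)=0$, $\mathrm{s}(\psi\vee\vartheta)=\mathrm{s}(\psi\wedge\vartheta)=\mathrm{s}(\psi)+\mathrm{s}(\vartheta)+1$, $\mathrm{s}(\Diamond\psi)=\mathrm{s}(\Box\psi)=\mathrm{s}(\psi)+1$. A formula separates $\mathbb{A}$ and $\mathbb{B}$ if every element of $\mathbb{A}$ satisfies it and no element of $\mathbb{B}$ satisfies it. $(\mathcal{M},w)$ and $(\mathcal{M}',w')$ are $n$-bisimilar if there are binary relations $Z_n\subseteq\dots\subseteq Z_0$ between points of $\mathcal{M}$ and points of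 $\mathcal{M}'$ such that $wZ_nw'$ and for every $0\le i\le n-1$: if $vZ_{i+1}v'$ and $vR^{\mathcal{M}}u$ then there is $u'$ with $v'R^{\mathcal{M}'}u'$ and $uZ_iu'$; and if $vZ_{i+1}v'$ and $v'R^{\mathcal{M}'}u'$ then there is $u$ with $vR^{\mathcal{M}}u$ and $uZ_iu'$. $\mathbb{A}_n$ is the class of all pointed frames $(\mathcal{A},w)$ such that for all $(\mathcal{A},u),(\mathcal{A},v)\in\Box(\mathcal{A},w)$ the pointed frames $(\mathcal{A},u)$ and $(\mathcal{A},v)$ are $n$-bisimilar; $\mathbb{B}_n$ is the complement of $\mathbb{A}_n$ in the class of all pointed frames. *)

theory Defs
  imports Main
begin

fun twr :: "nat \<Rightarrow> nat" where
  "twr 0 = 1"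
| "twr (Suc n) = 2 ^ twr n"

text \<open>A frame is a set of points together with an accessibility relation. The points are drawn
  from a type \<open>'a\<close>, and the carrier need not be all of \<open>'a\<close>. HOL cannot quantify over all types
  inside a hypothesis, so a class of pointed frames is taken relative to \<open>'a\<close>, and \<open>'a\<close> is to be
  read as an arbitrary infinite type. A formula that separates two classes over frames of every
  kind separates in particular their restrictions to frames with points in \<open>'a\<close>, so a lower bound
  proved over \<open>'a\<close> covers the unrestricted classes. Infinity of \<open>'a\<close> is needed for \<open>'a\<close> to contain
  a copy of each finite frame.\<close>

type_synonym 'a frame = "'a set \<times> ('a \<times> 'a) set"
type_synonym 'a pointed_frame = "'a frame \<times> 'a"

definition pointed_frames :: "'a pointed_frame set" where
  "pointed_frames = {((W, R), w) | W R w. R \<subseteq> W \<times> W \<and> w \<in> W}"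

fun box_succs :: "'a pointed_frame \<Rightarrow> 'a pointed_frame set" where
  "box_succs ((W, R), w) = {((W, R), v) | v. (w, v) \<in> R}"

datatype ml = Top | Bot | And ml ml | Or ml ml | Dia ml | Box ml

primrec sat :: "'a pointed_frame \<Rightarrow> ml \<Rightarrow> bool" where
  "sat P Top \<longleftrightarrow> True"
| "sat P Bot \<longleftrightarrow> False"
| "sat P (And \<phi> \<psi>) \<longleftrightarrow> sat P \<phi> \<and> sat P \<psi>"
| "sat P (Or \<phi> \<psi>) \<longleftrightarrow> sat P \<phi> \<or> sat P \<psi>"
| "sat P (Dia \<phi>) \<longleftrightarrow> (\<exists>Q\<in>box_succs P. sat Q \<phi>)"
| "sat P (Box \<phi>) \<longleftrightarrow> (\<forall>Q\<in>box_succs P. sat Q \<phi>)"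

primrec ml_size :: "ml \<Rightarrow> nat" where
  "ml_size Top = 0"
| "ml_size Bot = 0"
| "ml_size (And \<phi> \<psi>) = ml_size \<phi> + ml_size \<psi> + 1"
| "ml_size (Or \<phi> \<psi>) = ml_size \<phi> + ml_size \<psi> + 1"
| "ml_size (Dia \<phi>) = ml_size \<phi> + 1"
| "ml_size (Box \<phi>) = ml_size \<phi> + 1"

definition separates :: "ml \<Rightarrow> 'a pointed_frame set \<Rightarrow> 'a pointed_frame set \<Rightarrow> bool" where
  "separates \<phi> \<A> \<B> \<longleftrightarrow> (\<forall>P\<in>\<A>. sat P \<phi>) \<and> (\<forall>P\<in>\<B>. \<not> sat P \<phi>)"

text \<open>Only the members \<open>Z 0, \<dots>, Z n\<close> of the sequence \<open>Z\<close> are constrained.\<close>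

fun n_bisimilar :: "nat \<Rightarrow> 'a pointed_frame \<Rightarrow> 'b pointed_frame \<Rightarrow> bool" where
  "n_bisimilar n ((W, R), w) ((W', R'), w') \<longleftrightarrow>
    (\<exists>Z :: nat \<Rightarrow> ('a \<times> 'b) set.
      (\<forall>i\<le>n. Z i \<subseteq> W \<times> W') \<and>
      (\<forall>i<n. Z (Suc i) \<subseteq> Z i) \<and>
      (w, w') \<in> Z n \<and>
      (\<forall>i<n. \<forall>v v' u. (v, v') \<in> Z (Suc i) \<and> (v, u) \<in> R \<longrightarrow>
        (\<exists>u'. (v', u') \<in> R' \<and> (u, u') \<in> Z i)) \<and>
      (\<forall>i<n. \<forall>v v' u'. (v, v') \<in> Z (Suc i) \<and> (v', u') \<in> R' \<longrightarrow>
        (\<exists>u. (v, u) \<in> R \<and> (u, u') \<in> Z i)))"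

definition class_A :: "nat \<Rightarrow> 'a pointed_frame set" where
  "class_A n = {P \<in> pointed_frames. \<forall>Q\<in>box_succs P. \<forall>Q'\<in>box_succs P. n_bisimilar n Q Q'}"

definition class_B :: "nat \<Rightarrow> 'a pointed_frame set" where
  "class_B n = pointed_frames - class_A n"

end

theory Submission imports Defs begin

text \<open>Colour the points so that, whenever \<open>x\<close> and \<open>y\<close> have the same colour and \<open>\<theta>\<close> holds at a point
  with the only successor \<open>x\<close> and at a point with the only successor \<open>y\<close>, it also holds at a point
  with exactly the successors \<open>x\<close> and \<open>y\<close>. One colour suffices for \<open>\<diamond>\<psi>\<close> and for \<open>\<box>\<psi>\<close>, while the
  numbers of colours are multiplied at a conjunction and added at a disjunction, so \<open>2\<^sup>s\<close> colours
  suffice for size \<open>s\<close>. If \<open>\<theta>\<close> separates the two classes, then pairwise not \<open>n\<close>-bisimilar points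
  have distinct colours. In the frame of hereditarily finite sets, with the sets coded by natural
  numbers in Ackermann's way, the numbers below \<open>twr n\<close> are pairwise not \<open>n\<close>-bisimilar, hence
  \<open>twr n \<le> 2\<^sup>s\<close>.\<close>

lemma exists_colouring:
  fixes q :: "'i \<Rightarrow> 'a pointed_frame"
  assumes single: "\<And>x. box_succs (P x) = {q x}"
    and pair: "\<And>x y. box_succs (Q x y) = {q x, q y}"
  shows "\<exists>c :: 'i \<Rightarrow> nat. (\<forall>x. c x < 2 ^ ml_size \<phi>) \<and>
    (\<forall>x y. c x = c y \<and> sat (P x) \<phi> \<and> sat (P y) \<phi> \<longrightarrow> sat (Q x y) \<phi>)"
proof (induction \<phi>)
  case (And \<phi> \<psi>)
  then obtain c d :: "'i \<Rightarrow> nat"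
    where c: "\<And>x. c x < 2 ^ ml_size \<phi>"
        "\<And>x y. c x = c y \<and> sat (P x) \<phi> \<and> sat (P y) \<phi> \<Longrightarrow> sat (Q x y) \<phi>"
      and d: "\<And>x. d x < 2 ^ ml_size \<psi>"
        "\<And>x y. d x = d y \<and> sat (P x) \<psi> \<and> sat (P y) \<psi> \<Longrightarrow> sat (Q x y) \<psi>"
    by blast
  \<comment> \<open>The pair of colours is written as one number in base
    \<open>2 ^ ml_size \<psi>\<close>, so equal values of \<open>e\<close> mean equality of both
    colours.\<close>
  define e where "e x = d x + c x * 2 ^ ml_size \<psi>" for x
  have e_less: "e x < 2 ^ ml_size (And \<phi> \<psi>)" for x
  proof -
    have "e x < (c x + 1) * 2 ^ ml_size \<psi>"
      using d(1)[of x] by (simp add: e_def algebra_simps)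
    also have "\<dots> \<le> 2 ^ ml_size \<phi> * 2 ^ ml_size \<psi>"
      using c(1)[of x] by (intro mult_right_mono) auto
    also have "\<dots> \<le> 2 ^ ml_size (And \<phi> \<psi>)"
      by (simp add: power_add)
    finally show ?thesis .
  qed
  have "e x mod 2 ^ ml_size \<psi> = d x" "e x div 2 ^ ml_size \<psi> = c x" for x
    using d(1)[of x] by (simp_all add: e_def)
  then have "c x = c y \<and> d x = d y" if "e x = e y" for x y
    using that by metis
  then have "\<forall>x y. e x = e y \<and> sat (P x) (And \<phi> \<psi>) \<and> sat (P y) (And \<phi> \<psi>) \<longrightarrow>
      sat (Q x y) (And \<phi> \<psi>)"
    unfolding sat.simps using c(2) d(2) by blast
  with e_less show ?case by blast
next
  case (Or \<phi> \<psi>)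
  then obtain c d :: "'i \<Rightarrow> nat"
    where c: "\<And>x. c x < 2 ^ ml_size \<phi>"
        "\<And>x y. c x = c y \<and> sat (P x) \<phi> \<and> sat (P y) \<phi> \<Longrightarrow> sat (Q x y) \<phi>"
      and d: "\<And>x. d x < 2 ^ ml_size \<psi>"
        "\<And>x y. d x = d y \<and> sat (P x) \<psi> \<and> sat (P y) \<psi> \<Longrightarrow> sat (Q x y) \<psi>"
    by blast
  \<comment> \<open>The shift keeps the two palettes disjoint, so points of equal colour that
    satisfy the disjunction satisfy a common disjunct.\<close>
  define e where "e x = (if sat (P x) \<phi> then c x else 2 ^ ml_size \<phi> + d x)" for x
  have sum_le: "(2::nat) ^ a + 2 ^ b \<le> 2 ^ (a + b + 1)" for a b
  proof -
    have "(2::nat) ^ a + 2 ^ b \<le> 2 ^ (a + b) + 2 ^ (a + b)"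
      by (intro add_mono power_increasing) auto
    then show ?thesis by (simp add: mult_2)
  qed
  have "e x < 2 ^ ml_size (Or \<phi> \<psi>)" for x
    using c(1)[of x] d(1)[of x] sum_le[of "ml_size \<phi>" "ml_size \<psi>"] by (simp add: e_def)
  moreover have "sat (Q x y) (Or \<phi> \<psi>)"
    if eq: "e x = e y" and sat: "sat (P x) (Or \<phi> \<psi>)" "sat (P y) (Or \<phi> \<psi>)" for x y
  proof (cases "sat (P x) \<phi>"; cases "sat (P y) \<phi>")
    assume "sat (P x) \<phi>" "sat (P y) \<phi>"
    then show ?thesis using eq c(2)[of x y] by (simp add: e_def)
  next
    assume "\<not> sat (P x) \<phi>" "\<not> sat (P y) \<phi>"
    then show ?thesis using eq sat d(2)[of x y] by (simp add: e_def)
  qed (use eq c(1)[of x] c(1)[of y] in \<open>auto simp: e_def\<close>)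
  ultimately show ?case by blast
\<comment> \<open>For \<open>Dia\<close> the witness \<open>q x\<close> remains a successor; for
  \<open>Box\<close> both successors have already been checked separately.\<close>
qed (rule exI[of _ "\<lambda>_. 0"], simp add: single pair)+

text \<open>Serves to pass from a code below \<open>twr (Suc i)\<close> to its elements, which lie
  below \<open>twr i\<close>.\<close>

lemma bit_imp_less: "x < 2 ^ k \<Longrightarrow> bit (x :: nat) b \<Longrightarrow> b < k"
  by (metis bit_take_bit_iff take_bit_nat_eq_self_iff)

text \<open>\<open>bit x y\<close> says that \<open>y\<close> is an element of the set with code
  \<open>x\<close>; \<open>f\<close> carries the codes into the type \<open>'a\<close>.\<close>

abbreviation hf_frame :: "(nat \<Rightarrow> 'a) \<Rightarrow> 'a frame" where
  "hf_frame f \<equiv> (range f, {(f x, f y) | x y. bit x y})"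

lemma box_succs_hf_frame:
  "inj f \<Longrightarrow> box_succs (hf_frame f, f x) = (\<lambda>y. (hf_frame f, f y)) ` {y. bit x y}"
  by (auto dest: injD)

lemma n_bisimilar_refl:
  assumes "R \<subseteq> W \<times> W" "w \<in> W"
  shows "n_bisimilar n ((W, R), w) ((W, R), w)"
  using assms by (auto intro!: exI[of _ "\<lambda>_. Id_on W"])

text \<open>Extensionality, by induction on the level: \<open>Z (Suc i)\<close> matches the elements
  of two sets along \<open>Z i\<close>, which by induction is equality on codes below
  \<open>twr i\<close>.\<close>

lemma n_bisimilar_hf_frame_imp_eq:
  assumes f: "inj f" and bisim: "n_bisimilar n (hf_frame f, f x) (hf_frame f, f y)"
    and "x < twr n" "y < twr n"
  shows "x = y"
proof -
  obtain Z where Z: "(f x, f y) \<in> Z n"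
    and zig: "\<forall>i<n. \<forall>v v' u. (v, v') \<in> Z (Suc i) \<and> (v, u) \<in> snd (hf_frame f) \<longrightarrow>
      (\<exists>u'. (v', u') \<in> snd (hf_frame f) \<and> (u, u') \<in> Z i)"
    and zag: "\<forall>i<n. \<forall>v v' u'. (v, v') \<in> Z (Suc i) \<and> (v', u') \<in> snd (hf_frame f) \<longrightarrow>
      (\<exists>u. (v, u) \<in> snd (hf_frame f) \<and> (u, u') \<in> Z i)"
    using bisim by auto
  have R: "(f x, w) \<in> snd (hf_frame f) \<longleftrightarrow> (\<exists>y. w = f y \<and> bit x y)" for x w
    using f by (auto dest: injD)
  have zig_bit: "\<exists>v. bit y v \<and> (f u, f v) \<in> Z i"
    if "i < n" "(f x, f y) \<in> Z (Suc i)" "bit x u" for i x y u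
    using zig[rule_format, OF that(1), of "f x" "f y" "f u"] that unfolding R by blast
  have zag_bit: "\<exists>u. bit x u \<and> (f u, f v) \<in> Z i"
    if "i < n" "(f x, f y) \<in> Z (Suc i)" "bit y v" for i x y v
    using zag[rule_format, OF that(1), of "f x" "f y" "f v"] that unfolding R by blast
  have "x = y" if "i \<le> n" "(f x, f y) \<in> Z i" "x < twr i" "y < twr i" for i x y
    using that
  proof (induction i arbitrary: x y)
    case (Suc i)
    have less: "u < twr i" if "bit x u \<or> bit y u" for u
      using that Suc.prems bit_imp_less by auto
    show ?case
    proof (rule bit_eqI)
      have "i < n" using Suc.prems(1) by simp
      then show "bit x u = bit y u" for u
        using Suc.IH Suc.prems(2) less zig_bit[of i x y u] zag_bit[of i x y u] less_imp_le by blast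
    qed
  \<comment> \<open>At level 0 both codes are 0, as \<open>twr 0 = 1\<close>.\<close>
  qed simp
  then show ?thesis using Z assms by blast
qed

theorem theorem4p11:
  fixes n :: nat and \<theta> :: ml
  assumes "infinite (UNIV :: 'a set)"
    and "n \<ge> 1"
    and "separates \<theta> (class_A n :: 'a pointed_frame set) (class_B n :: 'a pointed_frame set)"
  shows "ml_size \<theta> \<ge> twr (n - 1)"
proof -
  obtain f :: "nat \<Rightarrow> 'a" where f: "inj f"
    using assms(1) infinite_countable_subset by blast
  define q where "q x = (hf_frame f, f x)" for x
  \<comment> \<open>\<open>2 ^ x\<close> codes the singleton of \<open>x\<close>, and setting bit
    \<open>y\<close> adds \<open>y\<close> as an element.\<close>
  define single pair :: "nat \<Rightarrow> _"
    where "single x = q (2 ^ x)" and "pair x = (\<lambda>y. q (set_bit y (2 ^ x)))" for x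
  have succs: "box_succs (single x) = {q x}" "box_succs (pair x y) = {q x, q y}" for x y
    unfolding single_def pair_def q_def box_succs_hf_frame[OF f]
    by (auto simp: bit_set_bit_iff bit_exp_iff)
  have pointed: "q x \<in> pointed_frames" for x
    by (auto simp: q_def pointed_frames_def)
  have refl: "n_bisimilar n (q x) (q x)" for x
    unfolding q_def by (rule n_bisimilar_refl) auto
  have sat_single: "sat (single x) \<theta>" for x
  proof -
    have "single x \<in> class_A n"
      unfolding class_A_def using pointed refl by (simp add: succs) (simp add: single_def)
    then show ?thesis using assms(3) by (simp add: separates_def)
  qed
  have not_sat_pair: "\<not> sat (pair x y) \<theta>" if "x < twr n" "y < twr n" "x \<noteq> y" for x y
  proof -
    have "\<not> n_bisimilar n (q x) (q y)"
      using n_bisimilar_hf_frame_imp_eq[OF f] that unfolding q_def by blast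
    then have "pair x y \<in> class_B n"
      using pointed by (auto simp: class_B_def class_A_def succs) (simp add: pair_def)
    then show ?thesis using assms(3) by (simp add: separates_def)
  qed
  obtain c :: "nat \<Rightarrow> nat" where c: "\<And>x. c x < 2 ^ ml_size \<theta>"
    and same: "\<And>x y. c x = c y \<Longrightarrow> sat (pair x y) \<theta>"
    using exists_colouring[of single q pair \<theta>] succs sat_single by blast
  \<comment> \<open>Two distinct numbers below \<open>twr n\<close> of one colour would make
    \<open>\<theta>\<close> true at their pair, a member of \<open>class_B n\<close>.\<close>
  have "inj_on c {..<twr n}"
    using same not_sat_pair unfolding inj_on_def by blast
  then have "card {..<twr n} \<le> card {..<(2::nat) ^ ml_size \<theta>}"
    using c by (intro card_inj_on_le) auto
  moreover have "twr n = 2 ^ twr (n - 1)"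
    using assms(2) by (cases n) auto
  ultimately show ?thesis by simp
qed

end
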